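(* Let $T$ be a traffic matrix and let $T^*=(T+T^{\top})/2$ be its symmetric counterpart. Let $a\in\mathbb{R}^{A\times K}$, $h\in\mathbb{R}^{M\times E}$ and $b\in\mathbb{R}$, and suppose that $$a_{ij}^{vu}=a_{ji}^{vu}=a_{ij}^{uv}=a_{ji}^{uv}\quad\text{for all } (ij)\in A \text{ and } (uv)\in K.$$ (i) If $ax+hy\ge b$ is a valid inequality for $U(T)$, then $\tfrac12 ax+hy\ge b$ is valid for $B(2T^* )$. (ii) Conversely, if $ax+hy\ge b$ is valid for $B(2T^* )$, then $2ax+hy\ge b$ is valid for $U(T)$.
   Context: $G=(N,E)$ is a finite undirected graph with edges $\{i,j\}$, $i\neq j$; $A$ is the arc set containing both arcs $(ij)$ and $(ji)$ for each edge $\{i,j\}\in E$. $M$ is a finite set of facility types; a unit of facility $m\in M$ provides capacity $c_m\in\mathbb{Z}$, with $c_1<c_2<\dots<c_{|M|}$. $\bar c\in\mathbb{R}^E$ is the vector of existing edge capacities. $K=\{(ij)\in N\times N : i\neq j\}$ is the set of commodities. A traffic matrix is a matrix $T=\{t_{ij}\}_{i,j\in N}$ with $t_{ij}\ge 0$. For $k=(ij)\in K$ and $u\in N$, let $d_u^k=t_{ij}$ if $u=j$, $d_u^k=-t_{ij}$ if $u=i$, and $d_u^k=0$ otherwise. Flow variables are $x=(x_{ij}^k)\in\mathbb{R}^{A\times K}$, and capacity variables are $y=(y_{m,e})\in\mathbb{R}^{M\times E}$. The flow balance constraints for $T$ are $$\sum_{j:(ij)\in A} x_{ij}^k-\sum_{j:(ji)\in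 A}x_{ji}^k=d_i^k\quad\text{for all } k\in K,\ i\in N.$$ $U(T)$ (undirected capacity model) is the set of $(x,y)$ with $x\ge 0$, $y\ge 0$, $y\in\mathbb{Z}^{M\times E}$ satisfying the flow balance constraints for $T$ and $$\sum_{k\in K}x_{ij}^k+\sum_{k\in K}x_{ji}^k\le \bar c_e+\sum_{m\in M}c_m y_{m,e}\quad\text{for all } e=\{i,j\}\in E.$$ $B(T)$ (bidirected capacity model) is the set of $(x,y)$ with $x\ge 0$, $y\ge 0$, $y\in\mathbb{Z}^{M\times E}$ satisfying the flow balance constraints for $T$ and $$\max\Big\{\sum_{k\in K}x_{ij}^k,\ \sum_{k\in K}x_{ji}^k\Big\}\le \bar c_e+\sum_{m\in M}c_m y_{m,e}\quad\text{for all } e=\{i,j\}\in E.$$ The same $G$, $M$, $c$ and $\bar c$ are used in both models; $B(2T^* )$ is the set for the traffic matrix $2T^*=T+T^{\top}$. Juxtaposition such as $ax$ denotes the standard inner product, and an inequality is valid for a set if every point of the set satisfies it. *)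

theory Defs
  imports Complex_Main "HOL-Library.FuncSet"
begin

text \<open>
  A simple undirected graph has its edges represented as two-element sets of nodes. Vectors
  indexed by a finite set \<open>I\<close> are functions in \<open>I \<rightarrow>\<^sub>E UNIV\<close>; in particular
  \<open>x ((i, j), k)\<close> is the flow of commodity \<open>k\<close> on the arc \<open>(i, j)\<close> and \<open>y (m, e)\<close> is the number of
  units of facility \<open>m\<close> installed on the edge \<open>e\<close>.
\<close>

definition simple_graph :: "'n set \<Rightarrow> 'n set set \<Rightarrow> bool" where
  "simple_graph N E \<longleftrightarrow>
     finite N \<and> (\<forall>e\<in>E. \<exists>i\<in>N. \<exists>j\<in>N. i \<noteq> j \<and> e = {i, j})"

definition arcs :: "'n set set \<Rightarrow> ('n \<times> 'n) set" where
  "arcs E = {(i, j). {i, j} \<in> E}"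

definition commodities :: "'n set \<Rightarrow> ('n \<times> 'n) set" where
  "commodities N = {(i, j). i \<in> N \<and> j \<in> N \<and> i \<noteq> j}"

definition traffic_matrix :: "'n set \<Rightarrow> ('n \<Rightarrow> 'n \<Rightarrow> real) \<Rightarrow> bool" where
  "traffic_matrix N T \<longleftrightarrow> (\<forall>i\<in>N. \<forall>j\<in>N. T i j \<ge> 0)"

definition symmetric_counterpart :: "('n \<Rightarrow> 'n \<Rightarrow> real) \<Rightarrow> 'n \<Rightarrow> 'n \<Rightarrow> real" where
  "symmetric_counterpart T i j = (T i j + T j i) / 2"

text \<open>The demand is positive at the second node of the commodity and negative at the first, while
  the balance constraint below is outflow minus inflow; this sign convention is the one of the
  source.\<close>

definition demand :: "('n \<Rightarrow> 'n \<Rightarrow> real) \<Rightarrow> 'n \<times> 'n \<Rightarrow> 'n \<Rightarrow> real" where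
  "demand T k u =
     (if u = snd k then T (fst k) (snd k)
      else if u = fst k then - T (fst k) (snd k)
      else 0)"

definition flow_balance ::
  "'n set \<Rightarrow> 'n set set \<Rightarrow> ('n \<Rightarrow> 'n \<Rightarrow> real) \<Rightarrow> (('n \<times> 'n) \<times> ('n \<times> 'n) \<Rightarrow> real) \<Rightarrow> bool" where
  "flow_balance N E T x \<longleftrightarrow>
     (\<forall>k\<in>commodities N. \<forall>i\<in>N.
        (\<Sum>j | (i, j) \<in> arcs E. x ((i, j), k)) - (\<Sum>j | (j, i) \<in> arcs E. x ((j, i), k))
        = demand T k i)"

definition undirected_model ::
  "'n set \<Rightarrow> 'n set set \<Rightarrow> 'm set \<Rightarrow> ('m \<Rightarrow> int) \<Rightarrow> ('n set \<Rightarrow> real) \<Rightarrow> ('n \<Rightarrow> 'n \<Rightarrow> real) \<Rightarrow>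
   ((('n \<times> 'n) \<times> ('n \<times> 'n) \<Rightarrow> real) \<times> ('m \<times> 'n set \<Rightarrow> real)) set" where
  "undirected_model N E M c cbar T =
     {(x, y). x \<in> (arcs E \<times> commodities N) \<rightarrow>\<^sub>E UNIV \<and> y \<in> (M \<times> E) \<rightarrow>\<^sub>E UNIV \<and>
        (\<forall>p\<in>arcs E \<times> commodities N. x p \<ge> 0) \<and>
        (\<forall>q\<in>M \<times> E. y q \<ge> 0 \<and> y q \<in> \<int>) \<and>
        flow_balance N E T x \<and>
        (\<forall>i j. {i, j} \<in> E \<longrightarrow>
           (\<Sum>k\<in>commodities N. x ((i, j), k)) + (\<Sum>k\<in>commodities N. x ((j, i), k))
           \<le> cbar {i, j} + (\<Sum>m\<in>M. of_int (c m) * y (m, {i, j})))}"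

definition bidirected_model ::
  "'n set \<Rightarrow> 'n set set \<Rightarrow> 'm set \<Rightarrow> ('m \<Rightarrow> int) \<Rightarrow> ('n set \<Rightarrow> real) \<Rightarrow> ('n \<Rightarrow> 'n \<Rightarrow> real) \<Rightarrow>
   ((('n \<times> 'n) \<times> ('n \<times> 'n) \<Rightarrow> real) \<times> ('m \<times> 'n set \<Rightarrow> real)) set" where
  "bidirected_model N E M c cbar T =
     {(x, y). x \<in> (arcs E \<times> commodities N) \<rightarrow>\<^sub>E UNIV \<and> y \<in> (M \<times> E) \<rightarrow>\<^sub>E UNIV \<and>
        (\<forall>p\<in>arcs E \<times> commodities N. x p \<ge> 0) \<and>
        (\<forall>q\<in>M \<times> E. y q \<ge> 0 \<and> y q \<in> \<int>) \<and>
        flow_balance N E T x \<and>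
        (\<forall>i j. {i, j} \<in> E \<longrightarrow>
           max (\<Sum>k\<in>commodities N. x ((i, j), k)) (\<Sum>k\<in>commodities N. x ((j, i), k))
           \<le> cbar {i, j} + (\<Sum>m\<in>M. of_int (c m) * y (m, {i, j})))}"

definition inner_on :: "'i set \<Rightarrow> ('i \<Rightarrow> real) \<Rightarrow> ('i \<Rightarrow> real) \<Rightarrow> real" where
  "inner_on I a x = (\<Sum>p\<in>I. a p * x p)"

text \<open>\<open>valid_ineq I J a h b S\<close>: the inequality \<open>a x + h y \<ge> b\<close> is valid for a set \<open>S\<close> of pairs of
  vectors indexed by \<open>I\<close> and \<open>J\<close>.\<close>

definition valid_ineq ::
  "'i set \<Rightarrow> 'j set \<Rightarrow> ('i \<Rightarrow> real) \<Rightarrow> ('j \<Rightarrow> real) \<Rightarrow> real \<Rightarrow> (('i \<Rightarrow> real) \<times> ('j \<Rightarrow> real)) set \<Rightarrow> bool"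
  where
  "valid_ineq I J a h b S \<longleftrightarrow> (\<forall>(x, y)\<in>S. inner_on I a x + inner_on J h y \<ge> b)"

end

theory Submission imports Defs begin

text \<open>
  Reversing the arc and the commodity at the same time turns a flow for \<open>T\<close> into a flow for the
  transpose of \<open>T\<close>. Adding a flow for \<open>T\<close> to its reversal gives a flow for \<open>2 T\<^sup>* \<close> whose load on
  each arc is the load of the original flow on the edge. Conversely, the average of a flow for
  \<open>2 T\<^sup>* \<close> and its reversal is split between the commodities \<open>(u, v)\<close> and \<open>(v, u)\<close> in the proportion
  of \<open>T u v\<close> and \<open>T v u\<close>; since the two shares add up to one, the load of the resulting flow on an
  edge is the mean of the two directed loads. The symmetry of \<open>a\<close> determines the objective value in
  both cases.
\<close>

section \<open>Reversal of arcs and commodities\<close>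

definition reversal :: "('n \<times> 'n) \<times> ('n \<times> 'n) \<Rightarrow> ('n \<times> 'n) \<times> ('n \<times> 'n)" where
  "reversal p = (prod.swap (fst p), prod.swap (snd p))"

lemma reversal_simp [simp]: "reversal ((i, j), k) = ((j, i), prod.swap k)"
  by (simp add: reversal_def)

lemma reversal_reversal [simp]: "reversal (reversal p) = p"
  by (simp add: reversal_def)

lemma snd_reversal [simp]: "snd (reversal p) = prod.swap (snd p)"
  by (simp add: reversal_def)

lemma arcs_commute: "(i, j) \<in> arcs E \<longleftrightarrow> (j, i) \<in> arcs E"
  by (simp add: arcs_def insert_commute)

lemma swap_in_commodities [simp]: "prod.swap k \<in> commodities N \<longleftrightarrow> k \<in> commodities N"
  by (cases k) (auto simp: commodities_def)

lemma reversal_in_index [simp]: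
  "reversal p \<in> arcs E \<times> commodities N \<longleftrightarrow> p \<in> arcs E \<times> commodities N"
  by (cases p) (auto simp: arcs_commute commodities_def)

lemma sum_swap_commodities:
  "(\<Sum>k\<in>commodities N. f (prod.swap k)) = (\<Sum>k\<in>commodities N. f k)"
  by (rule sum.reindex_bij_witness[where i = prod.swap and j = prod.swap]) auto

lemma sum_reversal:
  "(\<Sum>p\<in>arcs E \<times> commodities N. f (reversal p)) = (\<Sum>p\<in>arcs E \<times> commodities N. f p)"
  by (rule sum.reindex_bij_witness[where i = reversal and j = reversal])
    (simp_all only: reversal_reversal reversal_in_index)

section \<open>Operations that preserve flow balance\<close>

text \<open>This allows a flow to be cut down to the index set, as the extensional vectors of the
  models require, and the traffic matrix to be rewritten using facts that hold only on
  \<open>N\<close>.\<close>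

lemma flow_balance_cong:
  assumes "\<And>p. p \<in> arcs E \<times> commodities N \<Longrightarrow> x p = x' p"
    and "\<And>i j. i \<in> N \<Longrightarrow> j \<in> N \<Longrightarrow> T i j = T' i j"
  shows "flow_balance N E T x \<longleftrightarrow> flow_balance N E T' x'"
proof -
  have "demand T k i = demand T' k i" if "k \<in> commodities N" for k i
    using that assms(2) by (auto simp: demand_def commodities_def)
  then show ?thesis
    using assms(1) by (auto simp: flow_balance_def)
qed

text \<open>Two sign changes cancel: reversing arcs exchanges outflow and inflow, and swapping the
  commodity exchanges its source and sink.\<close>

lemma flow_balance_reversal:
  assumes "flow_balance N E T x"
  shows "flow_balance N E (\<lambda>i j. T j i) (\<lambda>p. x (reversal p))"
  unfolding flow_balance_def
proof (intro ballI)
  fix k i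
  assume k: "k \<in> commodities N" and i: "i \<in> N"
  have "(\<Sum>j | (i, j) \<in> arcs E. x ((i, j), prod.swap k))
      - (\<Sum>j | (j, i) \<in> arcs E. x ((j, i), prod.swap k)) = demand T (prod.swap k) i"
    using assms k i unfolding flow_balance_def by simp
  moreover have "demand T (prod.swap k) i = - demand (\<lambda>i j. T j i) k i"
    using k by (auto simp: demand_def commodities_def)
  ultimately show "(\<Sum>j | (i, j) \<in> arcs E. x (reversal ((i, j), k)))
      - (\<Sum>j | (j, i) \<in> arcs E. x (reversal ((j, i), k))) = demand (\<lambda>i j. T j i) k i"
    by (simp add: arcs_commute[of _ i])
qed

lemma flow_balance_add:
  assumes "flow_balance N E T x" and "flow_balance N E T' x'"
  shows "flow_balance N E (\<lambda>i j. T i j + T' i j) (\<lambda>p. x p + x' p)"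
  unfolding flow_balance_def
proof (intro ballI)
  fix k i
  assume "k \<in> commodities N" "i \<in> N"
  then have "(\<Sum>j | (i, j) \<in> arcs E. x ((i, j), k)) - (\<Sum>j | (j, i) \<in> arcs E. x ((j, i), k))
        = demand T k i"
    and "(\<Sum>j | (i, j) \<in> arcs E. x' ((i, j), k)) - (\<Sum>j | (j, i) \<in> arcs E. x' ((j, i), k))
        = demand T' k i"
    using assms unfolding flow_balance_def by blast+
  then show "(\<Sum>j | (i, j) \<in> arcs E. x ((i, j), k) + x' ((i, j), k))
      - (\<Sum>j | (j, i) \<in> arcs E. x ((j, i), k) + x' ((j, i), k))
      = demand (\<lambda>i j. T i j + T' i j) k i"
    by (auto simp: demand_def sum.distrib split: if_splits)
qed

text \<open>The weight may differ between commodities but not between arcs, so it factors out of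
  each balance equation. Constant weights give averages, and varying ones split traffic between a
  commodity and its swap.\<close>

lemma flow_balance_scale:
  assumes "flow_balance N E T x"
  shows "flow_balance N E (\<lambda>i j. w (i, j) * T i j) (\<lambda>p. w (snd p) * x p)"
  unfolding flow_balance_def
proof (intro ballI)
  fix k i
  assume "k \<in> commodities N" "i \<in> N"
  then have "(\<Sum>j | (i, j) \<in> arcs E. x ((i, j), k)) - (\<Sum>j | (j, i) \<in> arcs E. x ((j, i), k))
        = demand T k i"
    using assms unfolding flow_balance_def by blast
  then show "(\<Sum>j | (i, j) \<in> arcs E. w (snd ((i, j), k)) * x ((i, j), k))
      - (\<Sum>j | (j, i) \<in> arcs E. w (snd ((j, i), k)) * x ((j, i), k))
      = demand (\<lambda>i j. w (i, j) * T i j) k i"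
    by (auto simp: demand_def simp flip: sum_distrib_left right_diff_distrib)
qed

section \<open>Maps between the two models\<close>

text \<open>Since \<open>y\<close> stays fixed, only the \<open>a\<close> term of an inequality is
  rescaled.\<close>

lemma undirected_to_bidirected:
  assumes xy: "(x, y) \<in> undirected_model N E M c cbar T"
    and sym: "\<And>p. p \<in> arcs E \<times> commodities N \<Longrightarrow> a (reversal p) = a p"
  obtains x' where
    "(x', y) \<in> bidirected_model N E M c cbar (\<lambda>i j. 2 * symmetric_counterpart T i j)"
    "inner_on (arcs E \<times> commodities N) a x' = 2 * inner_on (arcs E \<times> commodities N) a x"
proof
  let ?I = "arcs E \<times> commodities N"
  define z where "z p = x p + x (reversal p)" for p
  have nonneg: "x p \<ge> 0" if "p \<in> ?I" for p
    using xy that unfolding undirected_model_def by blast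
  have bal: "flow_balance N E T x"
    using xy by (simp add: undirected_model_def)
  have "flow_balance N E (\<lambda>i j. T i j + T j i) z"
    unfolding z_def by (rule flow_balance_add[OF bal flow_balance_reversal[OF bal]])
  then have bal': "flow_balance N E (\<lambda>i j. 2 * symmetric_counterpart T i j) (restrict z ?I)"
    by (subst flow_balance_cong[where x' = z and T' = "\<lambda>i j. T i j + T j i"])
      (auto simp: symmetric_counterpart_def)
  \<comment> \<open>The right-hand side is symmetric in \<open>i\<close> and \<open>j\<close>, so
    both arguments of the maximum in the bidirected constraint equal the undirected load.\<close>
  have load: "(\<Sum>k\<in>commodities N. restrict z ?I ((i, j), k))
      = (\<Sum>k\<in>commodities N. x ((i, j), k)) + (\<Sum>k\<in>commodities N. x ((j, i), k))"
    if "(i, j) \<in> arcs E" for i j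
    using that sum_swap_commodities[of "\<lambda>k. x ((j, i), k)" N]
    by (simp add: z_def sum.distrib)
  have "max (\<Sum>k\<in>commodities N. restrict z ?I ((i, j), k))
      (\<Sum>k\<in>commodities N. restrict z ?I ((j, i), k))
      \<le> cbar {i, j} + (\<Sum>m\<in>M. of_int (c m) * y (m, {i, j}))" if "{i, j} \<in> E" for i j
  proof -
    have "(i, j) \<in> arcs E" "(j, i) \<in> arcs E"
      using that by (simp_all add: arcs_def insert_commute)
    moreover have "(\<Sum>k\<in>commodities N. x ((i, j), k)) + (\<Sum>k\<in>commodities N. x ((j, i), k))
        \<le> cbar {i, j} + (\<Sum>m\<in>M. of_int (c m) * y (m, {i, j}))"
      using xy that by (simp add: undirected_model_def)
    ultimately show ?thesis
      by (simp only: load)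
  qed
  moreover have "restrict z ?I p \<ge> 0" if "p \<in> ?I" for p
    using nonneg[OF that] nonneg[of "reversal p"] that by (simp only: reversal_in_index restrict_apply' z_def) simp
  moreover have "restrict z ?I \<in> ?I \<rightarrow>\<^sub>E UNIV"
    by simp
  ultimately show "(restrict z ?I, y)
      \<in> bidirected_model N E M c cbar (\<lambda>i j. 2 * symmetric_counterpart T i j)"
    using xy bal' unfolding bidirected_model_def undirected_model_def by blast
  \<comment> \<open>The symmetry of \<open>a\<close> turns the coefficient of
    \<open>x (reversal p)\<close> into \<open>a (reversal p)\<close>; the second summand is then a
    reindexed copy of the first.\<close>
  have "inner_on ?I a (restrict z ?I) = (\<Sum>p\<in>?I. a p * x p + a (reversal p) * x (reversal p))"
    unfolding inner_on_def by (rule sum.cong) (simp_all only: z_def sym restrict_apply' ring_distribs)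
  also have "\<dots> = 2 * inner_on ?I a x"
    by (simp only: sum.distrib sum_reversal[of "\<lambda>p. a p * x p"] inner_on_def mult_2)
  finally show "inner_on ?I a (restrict z ?I) = 2 * inner_on ?I a x" .
qed

lemma bidirected_to_undirected:
  assumes xy: "(x, y) \<in> bidirected_model N E M c cbar (\<lambda>i j. 2 * symmetric_counterpart T i j)"
    and T: "traffic_matrix N T"
    and sym: "\<And>p. p \<in> arcs E \<times> commodities N \<Longrightarrow> a (reversal p) = a p"
  obtains x' where
    "(x', y) \<in> undirected_model N E M c cbar T"
    "inner_on (arcs E \<times> commodities N) a x' = 1 / 2 * inner_on (arcs E \<times> commodities N) a x"
proof
  let ?I = "arcs E \<times> commodities N"
  define S where "S i j = 2 * symmetric_counterpart T i j" for i j
  \<comment> \<open>If \<open>T u v + T v u = 0\<close>, any two shares that add up to one will do.\<close>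
  define w where "w k = (if S (fst k) (snd k) = 0 then 1 / 2 else T (fst k) (snd k) / S (fst k) (snd k))"
    for k
  \<comment> \<open>Averaging makes the flow of \<open>(v, u)\<close> the exact reversal of the flow
    of \<open>(u, v)\<close>, so that the two shares of a split can recombine on each edge.\<close>
  define z where "z p = (x p + x (reversal p)) / 2" for p
  define f where "f p = w (snd p) * z p" for p
  have S_eq: "S i j = T i j + T j i" for i j
    by (simp add: S_def symmetric_counterpart_def)
  have w_sum: "w k + w (prod.swap k) = 1" for k
    by (auto simp: w_def S_eq add.commute simp flip: add_divide_distrib)
  \<comment> \<open>When \<open>S i j = 0\<close>, nonnegativity of the traffic forces
    \<open>T i j = 0\<close>, which makes the default share harmless.\<close>
  have w_S: "w (i, j) * S i j = T i j" if "i \<in> N" "j \<in> N" for i j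
    using T that by (auto simp: w_def S_eq traffic_matrix_def add_nonneg_eq_0_iff)
  have w_nonneg: "w k \<ge> 0" if "k \<in> commodities N" for k
    using T that by (auto simp: w_def S_eq traffic_matrix_def commodities_def)
  have z_reversal: "z (reversal p) = z p" for p
    by (simp add: z_def add.commute)
  have nonneg: "x p \<ge> 0" if "p \<in> ?I" for p
    using xy that unfolding bidirected_model_def by blast
  have z_nonneg: "z p \<ge> 0" if "p \<in> ?I" for p
    using nonneg[OF that] nonneg[of "reversal p"] that by (simp only: reversal_in_index z_def) simp
  have bal: "flow_balance N E S x"
    using xy by (simp add: bidirected_model_def S_def[abs_def])
  have "flow_balance N E (\<lambda>i j. 1 / 2 * (S i j + S j i)) (\<lambda>p. 1 / 2 * (x p + x (reversal p)))"
    using flow_balance_scale[OF flow_balance_add[OF bal flow_balance_reversal[OF bal]],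
        where w = "\<lambda>_. 1 / 2"] .
  \<comment> \<open>\<open>S\<close> is symmetric, so averaging it with its transpose gives
    \<open>S\<close> back.\<close>
  then have "flow_balance N E S z"
    by (subst flow_balance_cong) (auto simp: z_def S_eq)
  then have "flow_balance N E (\<lambda>i j. w (i, j) * S i j) f"
    unfolding f_def by (rule flow_balance_scale)
  then have bal': "flow_balance N E T (restrict f ?I)"
    by (subst flow_balance_cong[where x' = f and T' = "\<lambda>i j. w (i, j) * S i j"])
      (auto simp: w_S)
  \<comment> \<open>Swapping the commodities in the second sum makes \<open>w k\<close> and
    \<open>w (prod.swap k)\<close> multiply the same value \<open>z ((i, j), k)\<close>, and these
    weights sum to one.\<close>
  have load: "(\<Sum>k\<in>commodities N. f ((i, j), k)) + (\<Sum>k\<in>commodities N. f ((j, i), k))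
      = ((\<Sum>k\<in>commodities N. x ((i, j), k)) + (\<Sum>k\<in>commodities N. x ((j, i), k))) / 2" for i j
  proof -
    have "(\<Sum>k\<in>commodities N. f ((j, i), k)) = (\<Sum>k\<in>commodities N. f ((j, i), prod.swap k))"
      by (rule sum_swap_commodities[symmetric])
    also have "\<dots> = (\<Sum>k\<in>commodities N. w (prod.swap k) * z ((i, j), k))"
      using z_reversal[of "((i, j), _)"] by (simp add: f_def)
    finally have "(\<Sum>k\<in>commodities N. f ((i, j), k)) + (\<Sum>k\<in>commodities N. f ((j, i), k))
        = (\<Sum>k\<in>commodities N. (w k + w (prod.swap k)) * z ((i, j), k))"
      by (simp add: f_def sum.distrib ring_distribs)
    also have "\<dots> = (\<Sum>k\<in>commodities N. z ((i, j), k))"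
      by (simp add: w_sum)
    also have "\<dots> = ((\<Sum>k\<in>commodities N. x ((i, j), k)) + (\<Sum>k\<in>commodities N. x ((j, i), k))) / 2"
      using sum_swap_commodities[of "\<lambda>k. x ((j, i), k)" N]
      by (simp add: z_def sum.distrib flip: sum_divide_distrib)
    finally show ?thesis .
  qed
  have "(\<Sum>k\<in>commodities N. restrict f ?I ((i, j), k))
      + (\<Sum>k\<in>commodities N. restrict f ?I ((j, i), k))
      \<le> cbar {i, j} + (\<Sum>m\<in>M. of_int (c m) * y (m, {i, j}))" if "{i, j} \<in> E" for i j
  proof -
    have "(i, j) \<in> arcs E" "(j, i) \<in> arcs E"
      using that by (simp_all add: arcs_def insert_commute)
    \<comment> \<open>The mean of the two directed loads is at most their maximum.\<close>
    moreover have "max (\<Sum>k\<in>commodities N. x ((i, j), k)) (\<Sum>k\<in>commodities N. x ((j, i), k))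
        \<le> cbar {i, j} + (\<Sum>m\<in>M. of_int (c m) * y (m, {i, j}))"
      using xy that unfolding bidirected_model_def by blast
    ultimately show ?thesis
      using load[of i j] by simp
  qed
  moreover have "restrict f ?I p \<ge> 0" if "p \<in> ?I" for p
    using that z_nonneg[OF that] w_nonneg[of "snd p"] by (auto simp: f_def)
  moreover have "restrict f ?I \<in> ?I \<rightarrow>\<^sub>E UNIV"
    by simp
  ultimately show "(restrict f ?I, y) \<in> undirected_model N E M c cbar T"
    using xy bal' unfolding bidirected_model_def undirected_model_def by blast
  have "inner_on ?I a (restrict f ?I) = (\<Sum>p\<in>?I. a p * f p)"
    unfolding inner_on_def by (rule sum.cong) simp_all
  \<comment> \<open>Reindexing by \<open>reversal\<close> fixes \<open>a\<close> and
    \<open>z\<close> and changes only the weight. Adding both forms of the sum therefore eliminates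
    the weights.\<close>
  moreover have "(\<Sum>p\<in>?I. a p * f p) = (\<Sum>p\<in>?I. a p * (w (prod.swap (snd p)) * z p))"
    by (subst sum_reversal[symmetric], rule sum.cong)
      (simp_all only: f_def snd_reversal z_reversal sym)
  ultimately have "2 * inner_on ?I a (restrict f ?I)
      = (\<Sum>p\<in>?I. a p * f p) + (\<Sum>p\<in>?I. a p * (w (prod.swap (snd p)) * z p))"
    by simp
  also have "\<dots> = (\<Sum>p\<in>?I. a p * ((w (snd p) + w (prod.swap (snd p))) * z p))"
    by (simp only: f_def ring_distribs sum.distrib)
  also have "\<dots> = (\<Sum>p\<in>?I. (a p * x p + a (reversal p) * x (reversal p)) / 2)"
    by (rule sum.cong) (simp_all only: w_sum sym z_def ring_distribs times_divide_eq_right mult_1)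
  also have "\<dots> = inner_on ?I a x"
    by (simp only: sum.distrib sum_reversal[of "\<lambda>p. a p * x p"] inner_on_def
        sum_divide_distrib[symmetric]) simp
  finally show "inner_on ?I a (restrict f ?I) = 1 / 2 * inner_on ?I a x"
    by simp
qed

section \<open>Transfer of valid inequalities\<close>

theorem mainTheorem4:
  fixes N :: "'n set" and E :: "'n set set"
    and r :: nat and c :: "nat \<Rightarrow> int" and cbar :: "'n set \<Rightarrow> real"
    and T :: "'n \<Rightarrow> 'n \<Rightarrow> real"
    and a :: "('n \<times> 'n) \<times> ('n \<times> 'n) \<Rightarrow> real" and h :: "nat \<times> 'n set \<Rightarrow> real" and b :: real
  defines "M \<equiv> {1..r}"
    and "A \<equiv> arcs E"
    and "K \<equiv> commodities N"
  assumes "simple_graph N E"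
    and "strict_mono_on M c"
    and "traffic_matrix N T"
    and "\<forall>(i, j)\<in>A. \<forall>(u, v)\<in>K.
           a ((i, j), (v, u)) = a ((j, i), (v, u)) \<and>
           a ((j, i), (v, u)) = a ((i, j), (u, v)) \<and>
           a ((i, j), (u, v)) = a ((j, i), (u, v))"
  shows
    "(valid_ineq (A \<times> K) (M \<times> E) a h b (undirected_model N E M c cbar T) \<longrightarrow>
        valid_ineq (A \<times> K) (M \<times> E) (\<lambda>p. 1 / 2 * a p) h b
          (bidirected_model N E M c cbar (\<lambda>i j. 2 * symmetric_counterpart T i j))) \<and>
     (valid_ineq (A \<times> K) (M \<times> E) a h b
          (bidirected_model N E M c cbar (\<lambda>i j. 2 * symmetric_counterpart T i j)) \<longrightarrow>
        valid_ineq (A \<times> K) (M \<times> E) (\<lambda>p. 2 * a p) h b (undirected_model N E M c cbar T))"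
proof -
  have sym: "a (reversal p) = a p" if "p \<in> arcs E \<times> commodities N" for p
    using assms(7) that unfolding A_def K_def by fastforce
  have scale: "inner_on I (\<lambda>p. t * a p) x = t * inner_on I a x" for I t x
    by (simp add: inner_on_def sum_distrib_left mult.assoc)
  show ?thesis
    unfolding valid_ineq_def scale
  proof (intro conjI impI ballI; clarify)
    \<comment> \<open>Validity travels against the maps: a bidirected point is sent to an undirected
      one, where the inequality is assumed, and its value is pulled back.\<close>
    fix x y
    assume valid: "\<forall>(x, y)\<in>undirected_model N E M c cbar T.
        b \<le> inner_on (A \<times> K) a x + inner_on (M \<times> E) h y"
      and xy: "(x, y) \<in> bidirected_model N E M c cbar (\<lambda>i j. 2 * symmetric_counterpart T i j)"
    obtain x' where "(x', y) \<in> undirected_model N E M c cbar T"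
      "inner_on (A \<times> K) a x' = 1 / 2 * inner_on (A \<times> K) a x"
      unfolding A_def K_def by (rule bidirected_to_undirected[where a = a, OF xy assms(6) sym])
    then show "b \<le> 1 / 2 * inner_on (A \<times> K) a x + inner_on (M \<times> E) h y"
      using valid by fastforce
  next
    fix x y
    assume valid: "\<forall>(x, y)\<in>bidirected_model N E M c cbar (\<lambda>i j. 2 * symmetric_counterpart T i j).
        b \<le> inner_on (A \<times> K) a x + inner_on (M \<times> E) h y"
      and xy: "(x, y) \<in> undirected_model N E M c cbar T"
    obtain x' where "(x', y) \<in> bidirected_model N E M c cbar (\<lambda>i j. 2 * symmetric_counterpart T i j)"
      "inner_on (A \<times> K) a x' = 2 * inner_on (A \<times> K) a x"
      unfolding A_def K_def by (rule undirected_to_bidirected[where a = a, OF xy sym])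
    then show "b \<le> 2 * inner_on (A \<times> K) a x + inner_on (M \<times> E) h y"
      using valid by fastforce
  qed
qed

end
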